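(* Let $E$ be a Euclidean space and let $\mathfrak h\subset\mathfrak{so}(E)$ be a weak-Berger algebra. Then: (I) There exist an orthogonal decomposition $E=E_0\oplus E_1\oplus\cdots\oplus E_r$ and a corresponding decomposition into a direct sum of ideals $\mathfrak h=\{0\}\oplus\mathfrak h_1\oplus\mathfrak h_2\oplus\cdots\oplus\mathfrak h_r$ such that $\mathfrak h_i(E_j)=0$ if $i\neq j$, $\mathfrak h_i\subset\mathfrak{so}(E_i)$, and $\mathfrak h_i$ acts irreducibly on $E_i$ (for $i=1,\dots,r$; the summand $\{0\}$ corresponds to $E_0$, on which $\mathfrak h$ acts trivially). (II) For this decomposition, $\mathcal P(\mathfrak h)=\mathcal P(\mathfrak h_1)\oplus\cdots\oplus\mathcal P(\mathfrak h_r)$. In particular, $\mathfrak h_i\subset\mathfrak{so}(E_i)$ is a weak-Berger algebra for $i=1,\dots,r$.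
   Context: Let $E$ be a (finite-dimensional real) Euclidean space with inner product $\langle\cdot,\cdot\rangle$. For a subalgebra $\mathfrak h\subset\mathfrak{so}(E)$ put $\mathcal P(\mathfrak h)=\{P\in\mathrm{Hom}(E,\mathfrak h):\langle P(u)v,w\rangle+\langle P(v)w,u\rangle+\langle P(w)u,v\rangle=0\ \forall u,v,w\in E\}$ and $L(\mathcal P(\mathfrak h))=\mathrm{span}\{P(u):P\in\mathcal P(\mathfrak h),u\in E\}\subset\mathfrak h$. The subalgebra $\mathfrak h\subset\mathfrak{so}(E)$ is called a weak-Berger algebra if $L(\mathcal P(\mathfrak h))=\mathfrak h$. In (II), $\mathcal P(\mathfrak h_i)$ is taken with respect to $\mathfrak h_i\subset\mathfrak{so}(E_i)$, and an element $P_i\in\mathcal P(\mathfrak h_i)\subset\mathrm{Hom}(E_i,\mathfrak h_i)$ is viewed as an element of $\mathrm{Hom}(E,\mathfrak h)$ by extending it by zero on $E_j$, $j\ne i$. *)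

theory Defs
  imports "HOL-Analysis.Analysis"
begin

text \<open>
  Euclidean spaces are linear subspaces \<open>E\<close> of an ambient type of class
  \<open>euclidean_space\<close>, so that \<open>E\<close> and its summands are treated alike and the zero
  space is allowed. A linear map defined on \<open>E\<close> is identified with its extension by zero
  on the orthogonal complement of \<open>E\<close>. Under this identification \<open>so F\<close> is contained in
  \<open>so E\<close> and \<open>P_space F k\<close> in \<open>Hom(E, h)\<close> whenever \<open>F \<subseteq> E\<close> and \<open>k \<subseteq> h\<close>.
\<close>

definition is_direct_sum :: "'b::real_vector set \<Rightarrow> 'i set \<Rightarrow> ('i \<Rightarrow> 'b set) \<Rightarrow> bool" where
  "is_direct_sum W I V \<longleftrightarrow>
     finite I \<and> (\<forall>i\<in>I. subspace (V i)) \<and>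
     W = {(\<Sum>i\<in>I. x i) |x. \<forall>i\<in>I. x i \<in> V i} \<and>
     (\<forall>x. (\<forall>i\<in>I. x i \<in> V i) \<and> (\<Sum>i\<in>I. x i) = 0 \<longrightarrow> (\<forall>i\<in>I. x i = 0))"

definition is_orthogonal_sum :: "'a::real_inner set \<Rightarrow> 'i set \<Rightarrow> ('i \<Rightarrow> 'a set) \<Rightarrow> bool" where
  "is_orthogonal_sum W I V \<longleftrightarrow>
     is_direct_sum W I V \<and>
     (\<forall>i\<in>I. \<forall>j\<in>I. i \<noteq> j \<longrightarrow> (\<forall>x\<in>V i. \<forall>y\<in>V j. orthogonal x y))"

definition lie_bracket ::
  "('a::real_normed_vector \<Rightarrow>\<^sub>L 'a) \<Rightarrow> ('a \<Rightarrow>\<^sub>L 'a) \<Rightarrow> ('a \<Rightarrow>\<^sub>L 'a)" where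
  "lie_bracket A B = (A o\<^sub>L B) - (B o\<^sub>L A)"

definition lie_subalgebra ::
  "('a::real_normed_vector \<Rightarrow>\<^sub>L 'a) set \<Rightarrow> ('a \<Rightarrow>\<^sub>L 'a) set \<Rightarrow> bool" where
  "lie_subalgebra h g \<longleftrightarrow>
     h \<subseteq> g \<and> subspace h \<and> (\<forall>A\<in>h. \<forall>B\<in>h. lie_bracket A B \<in> h)"

definition lie_ideal ::
  "('a::real_normed_vector \<Rightarrow>\<^sub>L 'a) set \<Rightarrow> ('a \<Rightarrow>\<^sub>L 'a) set \<Rightarrow> bool" where
  "lie_ideal k h \<longleftrightarrow>
     k \<subseteq> h \<and> subspace k \<and> (\<forall>A\<in>h. \<forall>B\<in>k. lie_bracket A B \<in> k)"

definition so :: "'a::euclidean_space set \<Rightarrow> ('a \<Rightarrow>\<^sub>L 'a) set" where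
  "so E = {A. (\<forall>v\<in>E. blinfun_apply A v \<in> E) \<and>
              (\<forall>v\<in>orthogonal_comp E. blinfun_apply A v = 0) \<and>
              (\<forall>v\<in>E. \<forall>w\<in>E. blinfun_apply A v \<bullet> w = - (v \<bullet> blinfun_apply A w))}"

definition acts_irreducibly ::
  "('a::real_normed_vector \<Rightarrow>\<^sub>L 'a) set \<Rightarrow> 'a set \<Rightarrow> bool" where
  "acts_irreducibly h V \<longleftrightarrow>
     V \<noteq> {0} \<and>
     (\<forall>W. subspace W \<and> W \<subseteq> V \<and> (\<forall>A\<in>h. \<forall>w\<in>W. blinfun_apply A w \<in> W)
          \<longrightarrow> W = {0} \<or> W = V)"

definition P_space ::
  "'a::euclidean_space set \<Rightarrow> ('a \<Rightarrow>\<^sub>L 'a) set \<Rightarrow> ('a \<Rightarrow>\<^sub>L ('a \<Rightarrow>\<^sub>L 'a)) set" where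
  "P_space E h =
     {P. (\<forall>u\<in>E. blinfun_apply P u \<in> h) \<and>
         (\<forall>u\<in>orthogonal_comp E. blinfun_apply P u = 0) \<and>
         (\<forall>u\<in>E. \<forall>v\<in>E. \<forall>w\<in>E.
            blinfun_apply (blinfun_apply P u) v \<bullet> w +
            blinfun_apply (blinfun_apply P v) w \<bullet> u +
            blinfun_apply (blinfun_apply P w) u \<bullet> v = 0)}"

definition L_span ::
  "'a::euclidean_space set \<Rightarrow> ('a \<Rightarrow>\<^sub>L ('a \<Rightarrow>\<^sub>L 'a)) set \<Rightarrow> ('a \<Rightarrow>\<^sub>L 'a) set" where
  "L_span E Q = span {blinfun_apply P u |P u. P \<in> Q \<and> u \<in> E}"

definition weak_Berger :: "'a::euclidean_space set \<Rightarrow> ('a \<Rightarrow>\<^sub>L 'a) set \<Rightarrow> bool" where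
  "weak_Berger E h \<longleftrightarrow> lie_subalgebra h (so E) \<and> L_span E (P_space E h) = h"

end

theory Submission
  imports Defs
begin

text \<open>
  Decompose \<open>E\<close> orthogonally into the kernel \<open>F 0\<close> of \<open>h\<close> and irreducible invariant subspaces
  \<open>F 1, \<dots>, F r\<close>. For \<open>P\<close> in \<open>P_space E h\<close>, \<open>u\<close> in \<open>F i\<close> and \<open>v\<close>, \<open>w\<close> in \<open>F j\<close> with \<open>i \<noteq> j\<close>, the second
  and third terms of the cyclic identity vanish because \<open>h\<close> preserves \<open>F i\<close> and \<open>F j\<close>; hence
  \<open>P u\<close> vanishes on \<open>F j\<close>. So composing \<open>P u\<close> with the orthogonal projection to \<open>F i\<close> has the same
  effect as projecting the argument \<open>u\<close>. Since the \<open>P u\<close> span \<open>h\<close>, the algebra \<open>h\<close> is closed under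
  composition with these projections, and both \<open>h\<close> and \<open>P_space E h\<close> split accordingly.
\<close>

section \<open>Orthogonal projections\<close>

text \<open>Chosen as a bounded linear map, so that it composes with elements of \<open>so E\<close>
  and of \<open>P_space E h\<close>. For a subspace \<open>F\<close> the description determines it
  uniquely, and existence is shown next.\<close>

definition orth_proj :: "'a::euclidean_space set \<Rightarrow> 'a \<Rightarrow>\<^sub>L 'a" where
  "orth_proj F = (SOME p. \<forall>x. blinfun_apply p x \<in> F \<and> x - blinfun_apply p x \<in> orthogonal_comp F)"

lemma orth_proj_exists:
  fixes F :: "'a::euclidean_space set"
  assumes "subspace F"
  shows "\<exists>p :: 'a \<Rightarrow>\<^sub>L 'a. \<forall>x. p x \<in> F \<and> x - p x \<in> orthogonal_comp F"
proof -
  obtain B where B: "B \<subseteq> F" "pairwise orthogonal B" "\<And>x. x \<in> B \<Longrightarrow> norm x = 1"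
    "independent B" "card B = dim F" "span B = F"
    using orthonormal_basis_subspace[OF assms] by metis
  have fin: "finite B" using B(4) by (rule independent_imp_finite)
  define p where "p = (\<Sum>b\<in>B. blinfun_scaleR_left b o\<^sub>L blinfun_inner_left b)"
  have p: "p x = (\<Sum>b\<in>B. (x \<bullet> b) *\<^sub>R b)" for x
    unfolding p_def by (simp add: blinfun.sum_left inner_commute)
  have "p x \<in> F" for x
    unfolding p using B(1) assms by (intro subspace_sum subspace_scale) auto
  moreover have "x - p x \<in> orthogonal_comp F" for x
  proof -
    have "orthogonal (x - p x) c" if "c \<in> B" for c
    proof -
      have "p x \<bullet> c = (\<Sum>b\<in>B. if b = c then x \<bullet> c else 0)"
        unfolding p inner_sum_left using B(2,3) that
        by (intro sum.cong) (auto simp: pairwise_def orthogonal_def norm_eq_1)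
      also have "\<dots> = x \<bullet> c" using fin that by simp
      finally show ?thesis by (simp add: orthogonal_def inner_diff_left)
    qed
    then have "orthogonal (x - p x) y" if "y \<in> span B" for y
      using orthogonal_to_span[OF that] by blast
    then show ?thesis
      by (simp add: orthogonal_comp_def B(6) orthogonal_commute)
  qed
  ultimately show ?thesis by blast
qed

lemma
  fixes F :: "'a::euclidean_space set"
  assumes "subspace F"
  shows orth_proj_mem: "orth_proj F x \<in> F"
    and orth_proj_diff: "x - orth_proj F x \<in> orthogonal_comp F"
  using someI_ex[OF orth_proj_exists[OF assms]] unfolding orth_proj_def by auto

lemma orthogonal_comp_self_eq_0:
  "x \<in> F \<Longrightarrow> x \<in> orthogonal_comp F \<Longrightarrow> x = 0"
  by (auto simp: orthogonal_comp_def orthogonal_def)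

lemma orth_proj_id:
  assumes "subspace F" "x \<in> F"
  shows "orth_proj F x = x"
  using orthogonal_comp_self_eq_0[of "x - orth_proj F x" F] orth_proj_diff[OF assms(1), of x]
    orth_proj_mem[OF assms(1), of x] subspace_diff[OF assms(1)] assms(2)
  by auto

lemma orth_proj_eq_0:
  assumes "subspace F" "x \<in> orthogonal_comp F"
  shows "orth_proj F x = 0"
proof -
  have "x - (x - orth_proj F x) \<in> orthogonal_comp F"
    using assms orth_proj_diff[OF assms(1), of x] subspace_orthogonal_comp subspace_diff by blast
  then show ?thesis
    using orthogonal_comp_self_eq_0 orth_proj_mem[OF assms(1)] by fastforce
qed

lemma blinfun_apply_orth_proj:
  assumes "subspace F" and "\<And>x. x \<in> orthogonal_comp F \<Longrightarrow> blinfun_apply A x = 0"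
  shows "A (orth_proj F x) = A x"
  using assms(2)[OF orth_proj_diff[OF assms(1), of x]] by (simp add: blinfun.diff_right)

lemma inner_orth_proj:
  assumes "subspace F" "y \<in> F"
  shows "y \<bullet> orth_proj F x = y \<bullet> x"
  using orth_proj_diff[OF assms(1), of x] assms(2)
  by (auto simp: orthogonal_comp_def orthogonal_def inner_diff_right)

text \<open>Under the convention of extension by zero, the comparison on the complement is trivial
  and equality is decided on \<open>F\<close>.\<close>

lemma blinfun_eq_on_orthogonal_comp:
  fixes F :: "'a::euclidean_space set"
  assumes "subspace F"
    and "\<And>x. x \<in> F \<Longrightarrow> blinfun_apply A x = blinfun_apply B x"
    and "\<And>x. x \<in> orthogonal_comp F \<Longrightarrow> blinfun_apply A x = blinfun_apply B x"
  shows "A = B"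
proof (rule blinfun_eqI)
  fix x
  have "A (orth_proj F x + (x - orth_proj F x)) = B (orth_proj F x + (x - orth_proj F x))"
    unfolding blinfun.add_right
    using assms(2)[OF orth_proj_mem[OF assms(1)]] assms(3)[OF orth_proj_diff[OF assms(1)]] by metis
  then show "A x = B x" by simp
qed

section \<open>Orthogonal sums\<close>

lemma is_direct_sumI:
  assumes "finite I" "\<And>i. i \<in> I \<Longrightarrow> subspace (V i)"
    and "W = {(\<Sum>i\<in>I. x i) |x. \<forall>i\<in>I. x i \<in> V i}"
    and "\<And>x. \<forall>i\<in>I. x i \<in> V i \<Longrightarrow> (\<Sum>i\<in>I. x i) = 0 \<Longrightarrow> \<forall>i\<in>I. x i = 0"
  shows "is_direct_sum W I V"
  unfolding is_direct_sum_def
proof (intro conjI allI impI)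
  fix x assume "(\<forall>i\<in>I. x i \<in> V i) \<and> (\<Sum>i\<in>I. x i) = 0"
  then show "\<forall>i\<in>I. x i = 0" using assms(4)[of x] by simp
qed (use assms(1-3) in simp_all)

lemma is_direct_sum_subset:
  assumes "is_direct_sum W I V" "i \<in> I"
  shows "V i \<subseteq> W"
proof
  fix x assume x: "x \<in> V i"
  have fin: "finite I" and sub: "\<And>j. j \<in> I \<Longrightarrow> subspace (V j)"
    and W: "W = {(\<Sum>i\<in>I. y i) |y. \<forall>i\<in>I. y i \<in> V i}"
    using assms(1) unfolding is_direct_sum_def by auto
  have "(\<Sum>j\<in>I. if j = i then x else 0) = x" using fin assms(2) by simp
  moreover have "\<forall>j\<in>I. (if j = i then x else 0) \<in> V j" using x sub subspace_0 by auto
  ultimately show "x \<in> W"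
    unfolding W mem_Collect_eq by (intro exI[of _ "\<lambda>j. if j = i then x else 0"]) simp
qed

text \<open>Bridges the index sets of the final statement: \<open>h\<close> is summed over
  \<open>{0..r}\<close>, \<open>P_space E h\<close> only over \<open>{1..r}\<close>. Families over
  \<open>J\<close> correspond to families over \<open>I\<close> by padding with zeros.\<close>

lemma is_direct_sum_drop_trivial:
  assumes "is_direct_sum W I V" "J \<subseteq> I" "\<And>i. i \<in> I - J \<Longrightarrow> V i = {0}"
  shows "is_direct_sum W J V"
proof -
  have fin: "finite I" and sub: "\<And>j. j \<in> I \<Longrightarrow> subspace (V j)"
    and W: "W = {(\<Sum>i\<in>I. y i) |y. \<forall>i\<in>I. y i \<in> V i}"
    and ind: "\<And>x. \<forall>i\<in>I. x i \<in> V i \<Longrightarrow> (\<Sum>i\<in>I. x i) = 0 \<Longrightarrow> \<forall>i\<in>I. x i = 0"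
    using assms(1) unfolding is_direct_sum_def by auto
  define ext where "ext x j = (if j \<in> J then x j else 0)" for x :: "_ \<Rightarrow> 'a" and j
  have ext_mem: "\<forall>i\<in>I. ext x i \<in> V i" if "\<forall>i\<in>J. x i \<in> V i" for x
    using that sub subspace_0 by (auto simp: ext_def)
  have ext_sum: "(\<Sum>i\<in>I. ext x i) = (\<Sum>i\<in>J. x i)" for x
    unfolding ext_def using fin assms(2)
    by (simp add: sum.inter_restrict[symmetric] Int_absorb1)
  have "W = {(\<Sum>i\<in>J. y i) |y. \<forall>i\<in>J. y i \<in> V i}"
  proof (intro equalityI subsetI)
    fix w assume "w \<in> W"
    then obtain y where y: "w = (\<Sum>i\<in>I. y i)" "\<forall>i\<in>I. y i \<in> V i" unfolding W by auto
    have "w = (\<Sum>i\<in>J. y i)"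
      unfolding y(1) using fin assms(2,3) y(2) by (intro sum.mono_neutral_right) auto
    then show "w \<in> {(\<Sum>i\<in>J. y i) |y. \<forall>i\<in>J. y i \<in> V i}" using y(2) assms(2) by blast
  next
    fix w assume "w \<in> {(\<Sum>i\<in>J. y i) |y. \<forall>i\<in>J. y i \<in> V i}"
    then obtain y where y: "w = (\<Sum>i\<in>J. y i)" "\<forall>i\<in>J. y i \<in> V i" by auto
    then show "w \<in> W"
      unfolding W mem_Collect_eq using ext_mem[OF y(2)] by (intro exI[of _ "ext y"]) (simp add: ext_sum)
  qed
  moreover have "\<forall>i\<in>J. x i = 0" if "\<forall>i\<in>J. x i \<in> V i" "(\<Sum>i\<in>J. x i) = 0" for x
  proof
    fix i assume i: "i \<in> J"
    have "\<forall>i\<in>I. ext x i = 0" by (rule ind[OF ext_mem[OF that(1)]]) (simp add: ext_sum that(2))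
    then have "ext x i = 0" using i assms(2) by blast
    then show "x i = 0" using i by (simp add: ext_def)
  qed
  ultimately show ?thesis
    using finite_subset[OF assms(2) fin] assms(2) sub by (intro is_direct_sumI) auto
qed

text \<open>Each \<open>v\<close> in \<open>V\<close> is its projection to \<open>U\<close> plus a
  remainder, which stays in \<open>V\<close> because \<open>U \<subseteq> V\<close>. This serves
  both to peel off irreducible subspaces and to add the kernel of \<open>h\<close> at the
  end.\<close>

lemma is_orthogonal_sum_insert:
  fixes V U :: "'a::euclidean_space set"
  assumes V: "is_orthogonal_sum (V \<inter> orthogonal_comp U) I F"
    and "subspace V" "subspace U" "U \<subseteq> V" "i \<notin> I"
  shows "is_orthogonal_sum V (insert i I) (F(i := U))"
proof -
  let ?G = "F(i := U)"
  have fin: "finite I" and sub: "\<And>j. j \<in> I \<Longrightarrow> subspace (F j)"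
    and W: "V \<inter> orthogonal_comp U = {(\<Sum>i\<in>I. y i) |y. \<forall>i\<in>I. y i \<in> F i}"
    and ind: "\<And>x. \<forall>i\<in>I. x i \<in> F i \<Longrightarrow> (\<Sum>i\<in>I. x i) = 0 \<Longrightarrow> \<forall>i\<in>I. x i = 0"
    and ds: "is_direct_sum (V \<inter> orthogonal_comp U) I F"
    and orth: "\<forall>i\<in>I. \<forall>j\<in>I. i \<noteq> j \<longrightarrow> (\<forall>x\<in>F i. \<forall>y\<in>F j. orthogonal x y)"
    using V unfolding is_orthogonal_sum_def is_direct_sum_def by auto
  have FU: "F j \<subseteq> V \<inter> orthogonal_comp U" if "j \<in> I" for j
    using is_direct_sum_subset[OF ds that] .
  have sumG: "(\<Sum>j\<in>insert i I. x j) = x i + (\<Sum>j\<in>I. x j)" for x :: "_ \<Rightarrow> 'a"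
    using fin assms(5) by simp
  have memG: "(\<forall>j\<in>insert i I. x j \<in> ?G j) \<longleftrightarrow> x i \<in> U \<and> (\<forall>j\<in>I. x j \<in> F j)" for x
    using assms(5) by auto
  have orthG: "orthogonal x y"
    if "a \<in> insert i I" "b \<in> insert i I" "a \<noteq> b" "x \<in> ?G a" "y \<in> ?G b" for a b x y
  proof -
    have U: "orthogonal u f" "orthogonal f u" if "u \<in> U" "j \<in> I" "f \<in> F j" for u f j
      using FU[OF that(2)] that by (auto simp: orthogonal_comp_def orthogonal_commute)
    show ?thesis using that orth U by (auto split: if_splits)
  qed
  have "V = {(\<Sum>j\<in>insert i I. y j) |y. \<forall>j\<in>insert i I. y j \<in> ?G j}"
  proof (intro equalityI subsetI)
    fix v assume v: "v \<in> V"
    have pU: "orth_proj U v \<in> U" by (rule orth_proj_mem[OF assms(3)])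
    then have "v - orth_proj U v \<in> V \<inter> orthogonal_comp U"
      using v assms(2,3,4) orth_proj_diff[OF assms(3)] subspace_diff by blast
    then obtain y where y: "v - orth_proj U v = (\<Sum>j\<in>I. y j)" "\<forall>j\<in>I. y j \<in> F j"
      unfolding W by auto
    let ?y = "y(i := orth_proj U v)"
    have eq: "(\<Sum>j\<in>I. ?y j) = (\<Sum>j\<in>I. y j)"
      using assms(5) by (intro sum.cong) auto
    have "(\<Sum>j\<in>insert i I. ?y j) = v" unfolding sumG eq y(1)[symmetric] by simp
    moreover have "\<forall>j\<in>insert i I. ?y j \<in> ?G j" using y(2) pU assms(5) by auto
    ultimately show "v \<in> {(\<Sum>j\<in>insert i I. y j) |y. \<forall>j\<in>insert i I. y j \<in> ?G j}"
      unfolding mem_Collect_eq by (intro exI[of _ ?y]) simp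
  next
    fix v assume "v \<in> {(\<Sum>j\<in>insert i I. y j) |y. \<forall>j\<in>insert i I. y j \<in> ?G j}"
    then obtain y where y: "v = y i + (\<Sum>j\<in>I. y j)" "y i \<in> U" "\<forall>j\<in>I. y j \<in> F j"
      unfolding mem_Collect_eq sumG memG by auto
    have "(\<Sum>j\<in>I. y j) \<in> V" using W y(3) by auto
    then show "v \<in> V" using y assms(2,4) by (auto intro: subspace_add)
  qed
  moreover have "\<forall>j\<in>insert i I. x j = 0"
    if x: "\<forall>j\<in>insert i I. x j \<in> ?G j" and 0: "(\<Sum>j\<in>insert i I. x j) = 0" for x
  proof -
    have xi: "x i \<in> U" and xj: "\<forall>j\<in>I. x j \<in> F j" using x unfolding memG by auto
    \<comment> \<open>The remaining terms sum to an element orthogonal to \<open>U\<close>, so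
      \<open>x i\<close> lies in \<open>U\<close> and in its complement.\<close>
    have s: "(\<Sum>j\<in>I. x j) \<in> orthogonal_comp U" using xj W by auto
    have "x i = - (\<Sum>j\<in>I. x j)" using 0 unfolding sumG by (simp add: add_eq_0_iff)
    then have "x i \<in> orthogonal_comp U"
      using s subspace_neg[OF subspace_orthogonal_comp] by metis
    then have "x i = 0" using xi orthogonal_comp_self_eq_0 by blast
    then show ?thesis using ind[OF xj] 0 unfolding sumG by auto
  qed
  moreover have "subspace (?G j)" if "j \<in> insert i I" for j using that sub assms(3) by auto
  moreover have "finite (insert i I)" using fin by simp
  ultimately have "is_direct_sum V (insert i I) ?G" by (intro is_direct_sumI)
  then show ?thesis unfolding is_orthogonal_sum_def using orthG by blast
qed

section \<open>Complete reducibility\<close>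

definition invariant_under :: "('a::real_normed_vector \<Rightarrow>\<^sub>L 'a) set \<Rightarrow> 'a set \<Rightarrow> bool" where
  "invariant_under h V \<longleftrightarrow> (\<forall>A\<in>h. \<forall>v\<in>V. blinfun_apply A v \<in> V)"

lemma so_skew: "A \<in> so E \<Longrightarrow> v \<in> E \<Longrightarrow> w \<in> E \<Longrightarrow> A v \<bullet> w = - (v \<bullet> A w)"
  unfolding so_def by blast

text \<open>Skew-symmetry moves \<open>A\<close> onto the other factor:
  \<open>u \<bullet> A v\<close> is the negative of \<open>A u \<bullet> v\<close>, and
  \<open>A u\<close> is again in \<open>U\<close>.\<close>

lemma invariant_under_orthogonal_comp:
  assumes "h \<subseteq> so E" "V \<subseteq> E" "U \<subseteq> V" "invariant_under h V" "invariant_under h U"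
  shows "invariant_under h (V \<inter> orthogonal_comp U)"
  unfolding invariant_under_def
proof (intro ballI)
  fix A v assume A: "A \<in> h" and v: "v \<in> V \<inter> orthogonal_comp U"
  have "u \<bullet> A v = 0" if u: "u \<in> U" for u
  proof -
    have "A u \<bullet> v = - (u \<bullet> A v)" using assms A v u by (intro so_skew[of A E]) auto
    moreover have "A u \<in> U" using assms(5) A u unfolding invariant_under_def by blast
    ultimately show ?thesis using v by (auto simp: orthogonal_comp_def orthogonal_def)
  qed
  then show "A v \<in> V \<inter> orthogonal_comp U"
    using assms(4) A v unfolding invariant_under_def orthogonal_comp_def orthogonal_def by auto
qed

text \<open>The witness is a nonzero invariant subspace of least dimension.\<close>

lemma irreducible_subspace_exists:
  fixes V :: "'a::euclidean_space set"
  assumes "subspace V" "invariant_under h V" "V \<noteq> {0}"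
  obtains U where "subspace U" "U \<subseteq> V" "invariant_under h U" "acts_irreducibly h U"
proof -
  let ?S = "\<lambda>U. subspace U \<and> U \<subseteq> V \<and> invariant_under h U \<and> U \<noteq> {0}"
  obtain U where U: "?S U" and min: "\<And>W. ?S W \<Longrightarrow> dim U \<le> dim W"
    using ex_has_least_nat[of ?S V dim] assms by blast
  have "W = {0} \<or> W = U"
    if W: "subspace W" "W \<subseteq> U" "\<forall>A\<in>h. \<forall>w\<in>W. blinfun_apply A w \<in> W" for W
  proof (cases "W = {0}")
    case False
    then have "dim U \<le> dim W"
      using W U by (intro min) (auto simp: invariant_under_def)
    then show ?thesis using subspace_dim_equal[OF W(1) _ W(2)] U by blast
  qed auto
  then have "acts_irreducibly h U" unfolding acts_irreducibly_def using U by blast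
  then show ?thesis using that U by blast
qed

text \<open>Induction on the dimension: split off one irreducible subspace \<open>U\<close> and
  continue in its invariant complement within \<open>V\<close>.\<close>

lemma orthogonal_sum_of_irreducibles:
  fixes V :: "'a::euclidean_space set"
  assumes "h \<subseteq> so E" "V \<subseteq> E" "subspace V" "invariant_under h V"
  shows "\<exists>r F. is_orthogonal_sum V {1..r::nat} F \<and>
    (\<forall>i\<in>{1..r}. invariant_under h (F i) \<and> acts_irreducibly h (F i))"
  using assms(2-)
proof (induction "dim V" arbitrary: V rule: less_induct)
  case less
  show ?case
  proof (cases "V = {0}")
    case True
    \<comment> \<open>The zero space is the sum over the empty index set, so \<open>r = 0\<close> is
      allowed.\<close>
    then have "is_orthogonal_sum V {1..0::nat} (\<lambda>_. {0})"
      by (auto simp: is_orthogonal_sum_def is_direct_sum_def)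
    then show ?thesis by force
  next
    case False
    then obtain U where U: "subspace U" "U \<subseteq> V" "invariant_under h U" "acts_irreducibly h U"
      using irreducible_subspace_exists less.prems by metis
    let ?V = "V \<inter> orthogonal_comp U"
    have sub: "subspace ?V" using less.prems by (simp add: subspace_inter subspace_orthogonal_comp)
    \<comment> \<open>A nonzero vector of \<open>U\<close> shows that the complement is strictly
      smaller than \<open>V\<close>, as the induction requires.\<close>
    obtain u where u: "u \<in> U" "u \<noteq> 0"
      using U(1,4) subspace_0 unfolding acts_irreducibly_def by blast
    then have "u \<notin> ?V" using orthogonal_comp_self_eq_0 by blast
    then have "?V \<noteq> V" using u U(2) by blast
    then have "dim ?V < dim V"
      using subspace_dim_equal[OF sub less.prems(2)] by (meson Int_lower1 not_le)
    then obtain r F where F: "is_orthogonal_sum ?V {1..r::nat} F"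
      "\<forall>i\<in>{1..r}. invariant_under h (F i) \<and> acts_irreducibly h (F i)"
      using less.hyps[of ?V] sub less.prems U
        invariant_under_orthogonal_comp[OF assms(1) less.prems(1) U(2) less.prems(3) U(3)]
      by blast
    have "is_orthogonal_sum V (insert (Suc r) {1..r}) (F(Suc r := U))"
      by (rule is_orthogonal_sum_insert[OF F(1) less.prems(2) U(1,2)]) auto
    moreover have "insert (Suc r) {1..r} = {1..Suc r}" by auto
    ultimately have "is_orthogonal_sum V {1..Suc r} (F(Suc r := U))" by simp
    moreover have "\<forall>i\<in>{1..Suc r}. invariant_under h ((F(Suc r := U)) i) \<and>
        acts_irreducibly h ((F(Suc r := U)) i)"
      using F(2) U(3,4) by auto
    ultimately show ?thesis by blast
  qed
qed

section \<open>Splitting along an invariant orthogonal sum\<close>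

lemma subspace_P_space:
  assumes "subspace k"
  shows "subspace (P_space D k)"
proof -
  have "(P + Q) u v \<bullet> w + (P + Q) v w \<bullet> u + (P + Q) w u \<bullet> v = 0"
    if "P u v \<bullet> w + P v w \<bullet> u + P w u \<bullet> v = 0" "Q u v \<bullet> w + Q v w \<bullet> u + Q w u \<bullet> v = 0"
    for P Q :: "'a \<Rightarrow>\<^sub>L 'a \<Rightarrow>\<^sub>L 'a" and u v w
    using that by (simp add: blinfun.add_left inner_add_left)
  moreover have "(c *\<^sub>R P) u v \<bullet> w + (c *\<^sub>R P) v w \<bullet> u + (c *\<^sub>R P) w u \<bullet> v = 0"
    if "P u v \<bullet> w + P v w \<bullet> u + P w u \<bullet> v = 0" for P :: "'a \<Rightarrow>\<^sub>L 'a \<Rightarrow>\<^sub>L 'a" and c u v w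
    using that by (simp add: blinfun.scaleR_left distrib_left[symmetric])
  ultimately show ?thesis
    using assms unfolding P_space_def
    by (intro subspaceI) (auto simp: subspace_0 subspace_add subspace_scale blinfun.add_left blinfun.scaleR_left)
qed

lemma P_space_zero:
  assumes "subspace E"
  shows "P_space E {0} = {0}"
proof -
  have "P = 0" if "P \<in> P_space E {0}" for P
    using that by (intro blinfun_eq_on_orthogonal_comp[OF assms]) (auto simp: P_space_def)
  then show ?thesis by (auto simp: P_space_def)
qed

text \<open>The summands are assumed invariant only, so that the kernel of \<open>h\<close> and the
  irreducible subspaces form one family. Irreducibility enters separately in
  \<open>irreducible_part\<close>.\<close>

locale weak_Berger_decomposition =
  fixes E :: "'a::euclidean_space set" and h :: "('a \<Rightarrow>\<^sub>L 'a) set"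
    and I :: "'i set" and F :: "'i \<Rightarrow> 'a set"
  assumes subspace_E: "subspace E"
    and weak_Berger: "weak_Berger E h"
    and sum_E: "is_orthogonal_sum E I F"
    and invariant: "i \<in> I \<Longrightarrow> invariant_under h (F i)"
begin

lemma h_so: "h \<subseteq> so E" and subspace_h: "subspace h"
  and bracket_h: "A \<in> h \<Longrightarrow> B \<in> h \<Longrightarrow> lie_bracket A B \<in> h"
  and L_span_h: "L_span E (P_space E h) = h"
  using weak_Berger unfolding weak_Berger_def lie_subalgebra_def by auto

lemma finite_I: "finite I" and subspace_F: "i \<in> I \<Longrightarrow> subspace (F i)"
  and direct_E: "is_direct_sum E I F"
  using sum_E unfolding is_orthogonal_sum_def is_direct_sum_def by auto

lemma F_orthogonal:
  "i \<in> I \<Longrightarrow> j \<in> I \<Longrightarrow> i \<noteq> j \<Longrightarrow> x \<in> F i \<Longrightarrow> y \<in> F j \<Longrightarrow> x \<bullet> y = 0"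
  using sum_E unfolding is_orthogonal_sum_def orthogonal_def by blast

lemma F_subset: "i \<in> I \<Longrightarrow> F i \<subseteq> E"
  by (rule is_direct_sum_subset[OF direct_E])

lemma E_comp_subset: "i \<in> I \<Longrightarrow> orthogonal_comp E \<subseteq> orthogonal_comp (F i)"
  using F_subset by (auto simp: orthogonal_comp_def)

lemma h_F: "A \<in> h \<Longrightarrow> i \<in> I \<Longrightarrow> v \<in> F i \<Longrightarrow> A v \<in> F i"
  using invariant unfolding invariant_under_def by blast

lemma h_comp: "A \<in> h \<Longrightarrow> v \<in> orthogonal_comp E \<Longrightarrow> A v = 0"
  using h_so unfolding so_def by blast

lemma proj_F: "i \<in> I \<Longrightarrow> orth_proj (F i) x \<in> F i"
  by (rule orth_proj_mem[OF subspace_F])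

lemma proj_F_id: "i \<in> I \<Longrightarrow> x \<in> F i \<Longrightarrow> orth_proj (F i) x = x"
  by (rule orth_proj_id[OF subspace_F])

lemma proj_F_comp: "i \<in> I \<Longrightarrow> x \<in> orthogonal_comp E \<Longrightarrow> orth_proj (F i) x = 0"
  using orth_proj_eq_0[OF subspace_F] E_comp_subset by blast

lemma proj_F_other: "i \<in> I \<Longrightarrow> j \<in> I \<Longrightarrow> i \<noteq> j \<Longrightarrow> x \<in> F j \<Longrightarrow> orth_proj (F i) x = 0"
  by (rule orth_proj_eq_0[OF subspace_F])
    (auto simp: orthogonal_comp_def orthogonal_def F_orthogonal)

section \<open>Linear maps cut down to the summands\<close>

lemma blinfun_eqI_F:
  assumes "\<And>i x. i \<in> I \<Longrightarrow> x \<in> F i \<Longrightarrow> blinfun_apply A x = blinfun_apply B x"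
    and "\<And>x. x \<in> orthogonal_comp E \<Longrightarrow> blinfun_apply A x = blinfun_apply B x"
  shows "A = B"
proof (rule blinfun_eq_on_orthogonal_comp[OF subspace_E _ assms(2)])
  fix x assume "x \<in> E"
  then obtain y where "x = (\<Sum>i\<in>I. y i)" "\<forall>i\<in>I. y i \<in> F i"
    using direct_E unfolding is_direct_sum_def by auto
  then show "blinfun_apply A x = blinfun_apply B x"
    using assms(1) by (simp add: blinfun.sum_right)
qed

text \<open>On each \<open>F j\<close> only the term with index \<open>j\<close> survives. The
  target of \<open>A\<close> is arbitrary, so this applies to elements of \<open>h\<close> and of
  \<open>P_space E h\<close> alike.\<close>

lemma sum_compose_proj:
  assumes "\<And>x. x \<in> orthogonal_comp E \<Longrightarrow> blinfun_apply A x = 0"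
  shows "(\<Sum>i\<in>I. A o\<^sub>L orth_proj (F i)) = A"
proof (rule blinfun_eqI_F)
  fix j x assume j: "j \<in> I" "x \<in> F j"
  have "(\<Sum>i\<in>I. A o\<^sub>L orth_proj (F i)) x = (\<Sum>i\<in>I. if i = j then A x else 0)"
    unfolding blinfun.sum_left using j
    by (intro sum.cong) (auto simp: proj_F_id proj_F_other)
  then show "(\<Sum>i\<in>I. A o\<^sub>L orth_proj (F i)) x = A x" using finite_I j by simp
qed (simp add: blinfun.sum_left proj_F_comp assms)

text \<open>On \<open>F i\<close> every term other than \<open>x i\<close> vanishes, since
  \<open>F i\<close> is orthogonal to the other summands. This gives directness for both
  \<open>h\<close> and \<open>P_space E h\<close>.\<close>

lemma independent_maps:
  assumes x: "\<And>i v. i \<in> I \<Longrightarrow> v \<in> orthogonal_comp (F i) \<Longrightarrow> blinfun_apply (x i) v = 0"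
    and 0: "(\<Sum>i\<in>I. x i) = 0" and i: "i \<in> I"
  shows "x i = 0"
proof (rule blinfun_eq_on_orthogonal_comp[OF subspace_F[OF i]])
  fix v assume v: "v \<in> F i"
  have "(\<Sum>j\<in>I. x j) v = (\<Sum>j\<in>I. if j = i then x i v else 0)"
    unfolding blinfun.sum_left using v i
    by (intro sum.cong) (auto intro!: x simp: orthogonal_comp_def orthogonal_def F_orthogonal)
  then show "x i v = blinfun_apply 0 v" using finite_I i by (simp add: 0)
qed (simp add: x i)

section \<open>Consequences of the cyclic identity\<close>

lemma P_mem:
  assumes "P \<in> P_space E h"
  shows "P u \<in> h"
proof -
  have "P (orth_proj E u) \<in> h"
    using assms orth_proj_mem[OF subspace_E] unfolding P_space_def by blast
  moreover have "P (orth_proj E u) = P u"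
    by (rule blinfun_apply_orth_proj[OF subspace_E]) (use assms in \<open>simp add: P_space_def\<close>)
  ultimately show ?thesis by simp
qed

lemma P_vanishes:
  assumes P: "P \<in> P_space E h" and ij: "i \<in> I" "j \<in> I" "i \<noteq> j" and u: "u \<in> F i" and v: "v \<in> F j"
  shows "P u v = 0"
proof -
  \<comment> \<open>Testing the cyclic identity against \<open>P u v\<close> itself turns its first
    term into a squared norm; the other two pair vectors from different summands.\<close>
  define w where "w = P u v"
  have w: "w \<in> F j" unfolding w_def by (rule h_F[OF P_mem[OF P] ij(2) v])
  have "P u v \<bullet> w + P v w \<bullet> u + P w u \<bullet> v = 0"
    using P u v w F_subset[OF ij(1)] F_subset[OF ij(2)] unfolding P_space_def by blast
  moreover have "P v w \<bullet> u = 0"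
    by (rule F_orthogonal[OF ij(2,1) ij(3)[symmetric] h_F[OF P_mem[OF P] ij(2) w] u])
  moreover have "P w u \<bullet> v = 0"
    by (rule F_orthogonal[OF ij h_F[OF P_mem[OF P] ij(1) u] v])
  ultimately show ?thesis by (simp add: w_def)
qed

text \<open>The key identity: cutting down the endomorphism \<open>P u\<close> yields another value
  of \<open>P\<close>, and therefore an element of \<open>h\<close>.\<close>

lemma P_compose_proj:
  assumes P: "P \<in> P_space E h" and i: "i \<in> I"
  shows "P u o\<^sub>L orth_proj (F i) = P (orth_proj (F i) u)"
proof -
  have P0: "P u = 0" if "u \<in> orthogonal_comp E" for u
    using P that unfolding P_space_def by blast
  \<comment> \<open>Split the argument along the summands; on \<open>F k\<close> all terms with
    \<open>j \<noteq> k\<close> vanish by \<open>P_vanishes\<close>.\<close>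
  have u: "P u = (\<Sum>j\<in>I. P (orth_proj (F j) u))"
    using arg_cong[OF sum_compose_proj[of P, OF P0], of "\<lambda>Q. blinfun_apply Q u"]
    by (simp add: blinfun.sum_left)
  show ?thesis
  proof (rule blinfun_eqI_F)
    fix k x assume k: "k \<in> I" "x \<in> F k"
    show "blinfun_apply (P u o\<^sub>L orth_proj (F i)) x = blinfun_apply (P (orth_proj (F i) u)) x"
    proof (cases "k = i")
      case True
      have "(P u) x = (\<Sum>j\<in>I. if j = i then P (orth_proj (F i) u) x else 0)"
        unfolding u blinfun.sum_left using k True
        by (intro sum.cong) (auto intro: P_vanishes[OF P _ _ _ proj_F])
      then show ?thesis using True k finite_I by (simp add: proj_F_id)
    next
      case False
      then show ?thesis using k i P_vanishes[OF P i k(1) _ proj_F[OF i] k(2)]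
        by (simp add: proj_F_other)
    qed
  next
    fix x assume "x \<in> orthogonal_comp E"
    then show "blinfun_apply (P u o\<^sub>L orth_proj (F i)) x = blinfun_apply (P (orth_proj (F i) u)) x"
      by (simp add: proj_F_comp[OF i] h_comp[OF P_mem[OF P]])
  qed
qed

text \<open>The ideal belonging to \<open>F i\<close>: restrictions of elements of \<open>h\<close>
  to \<open>F i\<close>, extended by zero. Whether these maps lie in \<open>h\<close> is left open
  here and settled in \<open>part_subset\<close>.\<close>

definition part :: "'i \<Rightarrow> ('a \<Rightarrow>\<^sub>L 'a) set" where
  "part i = (\<lambda>A. A o\<^sub>L orth_proj (F i)) ` h"

lemma linear_compose_left: "linear (\<lambda>A. A o\<^sub>L (B :: 'a \<Rightarrow>\<^sub>L 'a))"
  by (rule bounded_linear.linear[OF bounded_bilinear.bounded_linear_left[OF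
    bounded_bilinear_blinfun_compose]])

lemma subspace_part: "subspace (part i)"
  unfolding part_def by (rule linear_subspace_image[OF linear_compose_left subspace_h])

lemma part_so:
  assumes i: "i \<in> I"
  shows "part i \<subseteq> so (F i)"
proof
  fix B assume "B \<in> part i"
  then obtain A where A: "A \<in> h" "B = A o\<^sub>L orth_proj (F i)" unfolding part_def by auto
  show "B \<in> so (F i)"
    unfolding so_def A(2)
    using i A(1) h_F h_so F_subset[OF i] orth_proj_eq_0[OF subspace_F[OF i]]
    by (auto simp: proj_F_id intro!: so_skew[of A E])
qed

text \<open>For \<open>u\<close> in \<open>F i\<close>, \<open>P_compose_proj\<close> shows that
  \<open>P u\<close> is unchanged by composition with the projection, hence lies in
  \<open>part i\<close>. The cyclic identity is inherited from \<open>E\<close>.\<close>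

lemma P_space_compose:
  assumes P: "P \<in> P_space E h" and i: "i \<in> I"
  shows "P o\<^sub>L orth_proj (F i) \<in> P_space (F i) (part i)"
proof -
  have "P u \<in> part i" if "u \<in> F i" for u
    using P_compose_proj[OF P i, of u] P_mem[OF P, of u] i that
    by (auto simp: part_def proj_F_id intro!: image_eqI[of _ _ "P u"])
  moreover have "orth_proj (F i) u = 0" if "u \<in> orthogonal_comp (F i)" for u
    using orth_proj_eq_0[OF subspace_F[OF i]] that .
  moreover have "P u v \<bullet> w + P v w \<bullet> u + P w u \<bullet> v = 0"
    if "u \<in> F i" "v \<in> F i" "w \<in> F i" for u v w
    using P that F_subset[OF i] unfolding P_space_def by blast
  ultimately show ?thesis
    unfolding P_space_def using i by (simp add: proj_F_id)
qed

text \<open>The claim is linear in \<open>A\<close>, and the values \<open>P u\<close> span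
  \<open>h\<close>, so it suffices to check it on these values.\<close>

lemma compose_L_span:
  assumes i: "i \<in> I" and A: "A \<in> h"
  shows "A o\<^sub>L orth_proj (F i) \<in> L_span (F i) (P_space (F i) (part i))"
proof -
  let ?L = "L_span (F i) (P_space (F i) (part i))"
  have "subspace {A. A o\<^sub>L orth_proj (F i) \<in> ?L}"
    using linear_subspace_vimage[OF linear_compose_left, of ?L]
    unfolding L_span_def vimage_def by simp
  moreover have "P u o\<^sub>L orth_proj (F i) \<in> ?L" if "P \<in> P_space E h" for P u
  proof -
    \<comment> \<open>This exhibits the generator: the cut-down \<open>P\<close>, evaluated at an
      argument in \<open>F i\<close>.\<close>
    have "P u o\<^sub>L orth_proj (F i) = (P o\<^sub>L orth_proj (F i)) (orth_proj (F i) u)"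
      using P_compose_proj[OF that i] i by (simp add: proj_F proj_F_id)
    then show ?thesis
      unfolding L_span_def using P_space_compose[OF that i] proj_F[OF i]
      by (intro span_base) blast
  qed
  ultimately have "L_span E (P_space E h) \<subseteq> {A. A o\<^sub>L orth_proj (F i) \<in> ?L}"
    unfolding L_span_def[of E] by (intro span_minimal) auto
  then show ?thesis using A L_span_h by blast
qed

lemma L_span_part:
  assumes i: "i \<in> I"
  shows "L_span (F i) (P_space (F i) (part i)) = part i"
proof
  show "L_span (F i) (P_space (F i) (part i)) \<subseteq> part i"
    unfolding L_span_def by (intro span_minimal subspace_part) (auto simp: P_space_def)
  show "part i \<subseteq> L_span (F i) (P_space (F i) (part i))"
    using compose_L_span[OF i] by (auto simp: part_def)
qed

text \<open>Rests on \<open>h\<close> being spanned by the values \<open>P u\<close>, each of which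
  stays in \<open>h\<close> after projection. A nonzero algebra acting diagonally on two copies of a
  space shows that invariance of the summands alone would not suffice.\<close>

lemma part_subset:
  assumes i: "i \<in> I"
  shows "part i \<subseteq> h"
proof -
  have "subspace {A. A o\<^sub>L orth_proj (F i) \<in> h}"
    using linear_subspace_vimage[OF linear_compose_left subspace_h] unfolding vimage_def by simp
  then have "L_span E (P_space E h) \<subseteq> {A. A o\<^sub>L orth_proj (F i) \<in> h}"
    unfolding L_span_def by (intro span_minimal) (auto simp: P_compose_proj[OF _ i] P_mem)
  then show ?thesis using L_span_h by (auto simp: part_def)
qed

lemma part_comp: "i \<in> I \<Longrightarrow> A \<in> part i \<Longrightarrow> v \<in> orthogonal_comp (F i) \<Longrightarrow> A v = 0"
  using part_so unfolding so_def by blast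

lemma part_vanishes:
  "i \<in> I \<Longrightarrow> j \<in> I \<Longrightarrow> i \<noteq> j \<Longrightarrow> A \<in> part i \<Longrightarrow> v \<in> F j \<Longrightarrow> A v = 0"
  by (auto simp: part_def proj_F_other)

section \<open>Splitting of \<open>h\<close> into ideals\<close>

lemma direct_sum_part: "is_direct_sum h I part"
proof -
  have "h = {(\<Sum>i\<in>I. x i) |x. \<forall>i\<in>I. x i \<in> part i}"
  proof (intro equalityI subsetI)
    fix A assume A: "A \<in> h"
    then have "A = (\<Sum>i\<in>I. A o\<^sub>L orth_proj (F i))"
      using sum_compose_proj[of A] h_comp by simp
    then show "A \<in> {(\<Sum>i\<in>I. x i) |x. \<forall>i\<in>I. x i \<in> part i}"
      using A unfolding part_def by blast
  next
    fix A assume "A \<in> {(\<Sum>i\<in>I. x i) |x. \<forall>i\<in>I. x i \<in> part i}"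
    then show "A \<in> h" using part_subset subspace_h by (auto intro!: subspace_sum)
  qed
  moreover have "\<forall>i\<in>I. x i = 0" if "\<forall>i\<in>I. x i \<in> part i" "(\<Sum>i\<in>I. x i) = 0" for x
    using independent_maps[of x] that part_comp by blast
  ultimately show ?thesis
    using finite_I subspace_part by (intro is_direct_sumI)
qed

lemma proj_commutes:
  assumes i: "i \<in> I" and A: "A \<in> h"
  shows "orth_proj (F i) o\<^sub>L A = A o\<^sub>L orth_proj (F i)"
proof (rule blinfun_eqI_F)
  fix j x assume "j \<in> I" "x \<in> F j"
  then show "blinfun_apply (orth_proj (F i) o\<^sub>L A) x = blinfun_apply (A o\<^sub>L orth_proj (F i)) x"
    using i A h_F[OF A] by (cases "i = j") (auto simp: proj_F_id proj_F_other)
qed (simp add: h_comp[OF A] proj_F_comp[OF i])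

text \<open>As \<open>A\<close> commutes with the projection, the bracket with a cut-down
  \<open>C\<close> is the cut-down of the bracket with \<open>C\<close>.\<close>

lemma bracket_part:
  assumes i: "i \<in> I" and A: "A \<in> h" and B: "B \<in> part i"
  shows "lie_bracket A B \<in> part i"
proof -
  obtain C where C: "C \<in> h" "B = C o\<^sub>L orth_proj (F i)" using B unfolding part_def by auto
  have "lie_bracket A B = lie_bracket A C o\<^sub>L orth_proj (F i)"
  proof (rule blinfun_eqI)
    fix x
    have "orth_proj (F i) (A x) = A (orth_proj (F i) x)"
      using proj_commutes[OF i A] by (metis blinfun_apply_blinfun_compose)
    then show "lie_bracket A B x = (lie_bracket A C o\<^sub>L orth_proj (F i)) x"
      by (simp add: lie_bracket_def C(2) blinfun.diff_left)
  qed
  then show ?thesis using bracket_h[OF A C(1)] unfolding part_def by auto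
qed

lemma ideal_part: "i \<in> I \<Longrightarrow> lie_ideal (part i) h"
  unfolding lie_ideal_def using part_subset subspace_part bracket_part by blast

lemma weak_Berger_part: "i \<in> I \<Longrightarrow> weak_Berger (F i) (part i)"
  unfolding weak_Berger_def lie_subalgebra_def
  using part_so subspace_part bracket_part part_subset L_span_part by blast

text \<open>On \<open>F i\<close> an element of \<open>h\<close> and its cut-down agree, so
  \<open>h\<close> and \<open>part i\<close> have the same invariant subspaces there.\<close>

lemma irreducible_part:
  assumes i: "i \<in> I" and irr: "acts_irreducibly h (F i)"
  shows "acts_irreducibly (part i) (F i)"
proof -
  have "A w \<in> W" if "\<forall>A\<in>part i. \<forall>w\<in>W. blinfun_apply A w \<in> W" "W \<subseteq> F i" "A \<in> h" "w \<in> W" for W A w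
  proof -
    have "(A o\<^sub>L orth_proj (F i)) w \<in> W" using that unfolding part_def by blast
    then show ?thesis using that proj_F_id[OF i, of w] by auto
  qed
  then show ?thesis using irr unfolding acts_irreducibly_def by metis
qed


text \<open>Each term of the cyclic identity depends only on the projections of \<open>u\<close>,
  \<open>v\<close>, \<open>w\<close> to \<open>F i\<close>, so the identity extends from
  \<open>F i\<close> to all vectors.\<close>

lemma P_space_part_subset:
  assumes i: "i \<in> I"
  shows "P_space (F i) (part i) \<subseteq> P_space E h"
proof
  fix Q assume Q: "Q \<in> P_space (F i) (part i)"
  let ?p = "orth_proj (F i)"
  have Q0: "Q u = 0" if "u \<in> orthogonal_comp (F i)" for u
    using Q that unfolding P_space_def by blast
  have Qp: "Q (?p u) = Q u" for u
    by (rule blinfun_apply_orth_proj[OF subspace_F[OF i] Q0])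
  have mem: "Q u \<in> part i" for u
  proof -
    have "Q (?p u) \<in> part i" using Q proj_F[OF i] unfolding P_space_def by blast
    then show ?thesis by (simp only: Qp)
  qed
  have red: "Q u v \<bullet> w = Q (?p u) (?p v) \<bullet> ?p w" for u v w
  proof -
    have "Q u (?p v) = Q u v"
      by (rule blinfun_apply_orth_proj[OF subspace_F[OF i] part_comp[OF i mem]])
    moreover have "Q u (?p v) \<in> F i"
      using part_so[OF i] mem proj_F[OF i] unfolding so_def by blast
    ultimately show ?thesis by (simp add: Qp inner_orth_proj[OF subspace_F[OF i]])
  qed
  have "Q u v \<bullet> w + Q v w \<bullet> u + Q w u \<bullet> v = 0" for u v w
    unfolding red[of u v w] red[of v w u] red[of w u v]
    using Q proj_F[OF i] unfolding P_space_def by blast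
  then show "Q \<in> P_space E h"
    unfolding P_space_def using mem part_subset[OF i] Q0 E_comp_subset[OF i] by blast
qed

text \<open>Precomposition with the projections splits \<open>P\<close> just as it splits an element
  of \<open>h\<close>.\<close>

lemma direct_sum_P_space: "is_direct_sum (P_space E h) I (\<lambda>i. P_space (F i) (part i))"
proof -
  let ?S = "{(\<Sum>i\<in>I. x i) |x. \<forall>i\<in>I. x i \<in> P_space (F i) (part i)}"
  have "P_space E h = ?S"
  proof (intro equalityI subsetI)
    fix P assume P: "P \<in> P_space E h"
    then have "P = (\<Sum>i\<in>I. P o\<^sub>L orth_proj (F i))"
      using sum_compose_proj[of P] unfolding P_space_def by simp
    then show "P \<in> ?S" using P_space_compose[OF P] by blast
  next
    fix P assume "P \<in> ?S"
    then show "P \<in> P_space E h"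
      using P_space_part_subset subspace_P_space[OF subspace_h] by (auto intro!: subspace_sum)
  qed
  moreover have "\<forall>i\<in>I. x i = 0"
    if "\<forall>i\<in>I. x i \<in> P_space (F i) (part i)" "(\<Sum>i\<in>I. x i) = 0" for x
    using independent_maps[of x] that unfolding P_space_def by blast
  ultimately show ?thesis
    using finite_I subspace_P_space[OF subspace_part] by (intro is_direct_sumI)
qed

lemma part_trivial:
  assumes "i \<in> I" "\<And>A v. A \<in> h \<Longrightarrow> v \<in> F i \<Longrightarrow> blinfun_apply A v = 0"
  shows "part i = {0}"
proof -
  have "A o\<^sub>L orth_proj (F i) = 0" if "A \<in> h" for A
    using assms that proj_F by (intro blinfun_eqI) auto
  then show ?thesis unfolding part_def using subspace_0[OF subspace_h] by force
qed

end

section \<open>Assembling the decompositions\<close>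

theorem theorem4:
  fixes E :: "'a::euclidean_space set" and h :: "('a \<Rightarrow>\<^sub>L 'a) set"
  assumes "subspace E" and "weak_Berger E h"
  shows "\<exists>(r::nat) (F :: nat \<Rightarrow> 'a set) (k :: nat \<Rightarrow> ('a \<Rightarrow>\<^sub>L 'a) set).
    (is_orthogonal_sum E {0..r} F \<and>
     k 0 = {0} \<and>
     is_direct_sum h {0..r} k \<and>
     (\<forall>i\<in>{0..r}. lie_ideal (k i) h) \<and>
     (\<forall>i\<in>{0..r}. \<forall>j\<in>{0..r}. i \<noteq> j \<longrightarrow> (\<forall>A\<in>k i. \<forall>v\<in>F j. blinfun_apply A v = 0)) \<and>
     (\<forall>i\<in>{1..r}. k i \<subseteq> so (F i)) \<and>
     (\<forall>i\<in>{1..r}. acts_irreducibly (k i) (F i)) \<and>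
     (\<forall>A\<in>h. \<forall>v\<in>F 0. blinfun_apply A v = 0)) \<and>
    (is_direct_sum (P_space E h) {1..r} (\<lambda>i. P_space (F i) (k i)) \<and>
     (\<forall>i\<in>{1..r}. weak_Berger (F i) (k i)))"
proof -
  have hso: "h \<subseteq> so E" using assms(2) unfolding weak_Berger_def lie_subalgebra_def by blast
  \<comment> \<open>The kernel of \<open>h\<close> becomes the summand at index \<open>0\<close>; it
    may be \<open>{0}\<close>.\<close>
  define K where "K = {v \<in> E. \<forall>A\<in>h. blinfun_apply A v = 0}"
  have K: "subspace K" "K \<subseteq> E" "invariant_under h K"
    using assms(1)
    by (auto simp: K_def subspace_def invariant_under_def blinfun.add_right blinfun.scaleR_right)
  have E: "invariant_under h E" using hso unfolding invariant_under_def so_def by blast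
  have "subspace (E \<inter> orthogonal_comp K)"
    using assms(1) by (simp add: subspace_inter subspace_orthogonal_comp)
  then obtain r F where F: "is_orthogonal_sum (E \<inter> orthogonal_comp K) {1..r::nat} F"
    and Fi: "\<forall>i\<in>{1..r}. invariant_under h (F i) \<and> acts_irreducibly h (F i)"
    using orthogonal_sum_of_irreducibles[OF hso]
      invariant_under_orthogonal_comp[OF hso order_refl K(2) E K(3)] by blast
  \<comment> \<open>The irreducible summands occupy the indices from \<open>1\<close> on, so index
    \<open>0\<close> is free for the kernel.\<close>
  define G where "G = F(0 := K)"
  have "insert 0 {1..r} = {0..r}" by auto
  then have G: "is_orthogonal_sum E {0..r} G"
    using is_orthogonal_sum_insert[OF F assms(1) K(1,2), of 0] by (simp add: G_def)
  interpret weak_Berger_decomposition E h "{0..r}" G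
    using assms G K(3) Fi by unfold_locales (auto simp: G_def)
  have G0: "A v = 0" if "A \<in> h" "v \<in> G 0" for A v
    using that by (auto simp: G_def K_def)
  have part0: "part 0 = {0}" by (rule part_trivial) (auto simp: G0)
  have irr: "acts_irreducibly (part i) (G i)" if "i \<in> {1..r}" for i
    using irreducible_part[of i] Fi that by (auto simp: G_def)
  \<comment> \<open>The splitting over \<open>{0..r}\<close> loses index \<open>0\<close>, where
    \<open>part 0 = {0}\<close> admits only the zero map.\<close>
  have "is_direct_sum (P_space E h) {1..r} (\<lambda>i. P_space (G i) (part i))"
  proof (rule is_direct_sum_drop_trivial[OF direct_sum_P_space])
    fix i assume "i \<in> {0..r} - {1..r}"
    then have "i = 0" by auto
    then show "P_space (G i) (part i) = {0}"
      using part0 P_space_zero subspace_F[of 0] by simp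
  qed auto
  then show ?thesis
    using G part0 direct_sum_part ideal_part part_vanishes part_so irr G0 weak_Berger_part
    by (intro exI[of _ r] exI[of _ G] exI[of _ part]) auto
qed

end
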